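(* Let $X_{\mathrm{opt}}\in\mathbb{O}^{n\times k}$ be a local or global maximizer of $\max_{X\in\mathbb{O}^{n\times k}} f_\theta(X)$. (a) If $X_{\mathrm{opt}}$ is a global maximizer, then $X_{\mathrm{opt}}^{T}D\succeq 0$ (symmetric positive semidefinite). (b) If $X_{\mathrm{opt}}^{T}D\succeq 0$ and $\mathrm{trace}(X_{\mathrm{opt}}^{T}AX_{\mathrm{opt}}+X_{\mathrm{opt}}^{T}D)\ge 0$, then $X_{\mathrm{opt}}$ is an orthonormal basis matrix of the invariant subspace associated with the $k$ largest eigenvalues of $E(X_{\mathrm{opt}})$.
   Context: Standing setting: $1\le k<n$; $A,B\in\mathbb{R}^{n\times n}$ are symmetric, $B$ is positive semidefinite with $\mathrm{rank}(B)>n-k$; $D\in\mathbb{R}^{n\times k}$; $0\le\theta\le 1$. $\mathbb{O}^{n\times k}=\{X\in\mathbb{R}^{n\times k}: X^{T}X=I_k\}$. For $X\in\mathbb{O}^{n\times k}$, $$f_\theta(X)=\frac{\mathrm{trace}(X^{T}AX+X^{T}D)}{[\mathrm{trace}(X^{T}BX)]^{\theta}},\qquad f_1(X)=\frac{\mathrm{trace}(X^{T}AX+X^{T}D)}{\mathrm{trace}(X^{T}BX)},$$ $$E(X)=\frac{2}{[\mathrm{trace}(X^{T}BX)]^{\theta}}\Big[A+\frac{DX^{T}+XD^{T}}{2}-\theta f_1(X)B\Big].$$ $M\succeq 0$ means $M$ is symmetric positive semidefinite. Eigenvalues are counted with multiplicity; an invariant subspace associated with the $k$ largest eigenvalues of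 a symmetric matrix is one spanned by $k$ orthonormal eigenvectors belonging to the $k$ largest eigenvalues. *)

theory Defs
  imports
    "HOL-Analysis.Analysis"
    "HOL-Computational_Algebra.Polynomial"
begin

text \<open>
  An \<open>n \<times> k\<close> real matrix has type \<open>real ^ 'k ^ 'n\<close>, with \<open>n = CARD('n)\<close> and \<open>k = CARD('k)\<close>.
  The norm of this type, which determines the neighbourhoods below, is the Frobenius norm.
\<close>

definition symmetric_mat :: "real ^ 'n ^ 'n \<Rightarrow> bool" where
  "symmetric_mat M \<longleftrightarrow> transpose M = M"

definition psd :: "real ^ 'n ^ 'n \<Rightarrow> bool" where
  "psd M \<longleftrightarrow> symmetric_mat M \<and> (\<forall>v. 0 \<le> v \<bullet> (M *v v))"

definition stiefel :: "(real ^ 'k ^ 'n) set" where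
  "stiefel = {X. transpose X ** X = mat 1}"

definition f_num :: "real ^ 'n ^ 'n \<Rightarrow> real ^ 'k ^ 'n \<Rightarrow> real ^ 'k ^ 'n \<Rightarrow> real" where
  "f_num A D X = trace (transpose X ** A ** X + transpose X ** D)"

text \<open>
  Where \<open>rank B > n - k\<close> and \<open>B\<close> is positive semidefinite, the base of \<open>powr\<close> below is positive
  on \<open>stiefel\<close>, so the conventions \<open>0 powr \<theta> = 0\<close> and \<open>x / 0 = 0\<close> play no role.
\<close>

definition f_theta ::
  "real \<Rightarrow> real ^ 'n ^ 'n \<Rightarrow> real ^ 'n ^ 'n \<Rightarrow> real ^ 'k ^ 'n \<Rightarrow> real ^ 'k ^ 'n \<Rightarrow> real" where
  "f_theta \<theta> A B D X = f_num A D X / trace (transpose X ** B ** X) powr \<theta>"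

definition f_one ::
  "real ^ 'n ^ 'n \<Rightarrow> real ^ 'n ^ 'n \<Rightarrow> real ^ 'k ^ 'n \<Rightarrow> real ^ 'k ^ 'n \<Rightarrow> real" where
  "f_one A B D X = f_num A D X / trace (transpose X ** B ** X)"

definition E_mat ::
  "real \<Rightarrow> real ^ 'n ^ 'n \<Rightarrow> real ^ 'n ^ 'n \<Rightarrow> real ^ 'k ^ 'n \<Rightarrow> real ^ 'k ^ 'n \<Rightarrow> real ^ 'n ^ 'n"
where
  "E_mat \<theta> A B D X =
     (2 / trace (transpose X ** B ** X) powr \<theta>) *\<^sub>R
       (A + (1 / 2) *\<^sub>R (D ** transpose X + X ** transpose D) - (\<theta> * f_one A B D X) *\<^sub>R B)"

definition global_maximizer_on :: "('a \<Rightarrow> real) \<Rightarrow> 'a set \<Rightarrow> 'a \<Rightarrow> bool" where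
  "global_maximizer_on f S x \<longleftrightarrow> x \<in> S \<and> (\<forall>y\<in>S. f y \<le> f x)"

definition local_maximizer_on :: "('a::metric_space \<Rightarrow> real) \<Rightarrow> 'a set \<Rightarrow> 'a \<Rightarrow> bool" where
  "local_maximizer_on f S x \<longleftrightarrow>
     x \<in> S \<and> (\<exists>\<epsilon>>0. \<forall>y\<in>S. dist y x < \<epsilon> \<longrightarrow> f y \<le> f x)"

definition charpoly :: "real ^ 'n ^ 'n \<Rightarrow> real poly" where
  "charpoly M = det (\<chi> i j. (if i = j then [:0, 1:] else 0) - [:M $ i $ j:])"

text \<open>
  The real eigenvalues in descending order, each repeated according to its algebraic multiplicity.
  For a symmetric matrix this list has length \<open>n\<close>.
\<close>

definition eigvals_desc :: "real ^ 'n ^ 'n \<Rightarrow> real list" where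
  "eigvals_desc M = rev (sorted_list_of_multiset (proots (charpoly M)))"

definition top_invariant_subspace :: "nat \<Rightarrow> real ^ 'n ^ 'n \<Rightarrow> (real ^ 'n) set \<Rightarrow> bool" where
  "top_invariant_subspace k M V \<longleftrightarrow>
     k \<le> length (eigvals_desc M) \<and>
     (\<exists>u :: nat \<Rightarrow> real ^ 'n.
        (\<forall>i<k. \<forall>j<k. u i \<bullet> u j = (if i = j then 1 else 0)) \<and>
        (\<forall>i<k. M *v u i = (eigvals_desc M ! i) *\<^sub>R u i) \<and>
        V = span (u ` {..<k}))"

definition orthonormal_basis_matrix :: "real ^ 'k ^ 'n \<Rightarrow> (real ^ 'n) set \<Rightarrow> bool" where
  "orthonormal_basis_matrix X V \<longleftrightarrow> X \<in> stiefel \<and> span (columns X) = V"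

end

theory Submission
  imports Defs
begin

text \<open>
  Part (a). Replacing \<open>X\<close> by \<open>X Q\<close> with \<open>Q\<close> orthogonal changes neither \<open>trace (X\<^sup>T A X)\<close> nor
  \<open>trace (X\<^sup>T B X)\<close>, so a global maximizer also maximizes \<open>trace (Q\<^sup>T X\<^sup>T D)\<close> at \<open>Q = 1\<close>.
  A matrix \<open>M\<close> for which the identity maximizes \<open>trace (Q\<^sup>T M)\<close> is positive semidefinite:
  reflections \<open>Q\<close> give \<open>v\<^sup>T M v \<ge> 0\<close> and plane rotations give \<open>M\<^sup>T = M\<close>
  (\<open>psd_of_trace_maximal\<close>).

  Part (b). The idea is to trade the quotient for a quadratic function. Put
  \<open>F = A - \<theta> f\<^sub>1(X) B\<close>. By Young's inequality \<open>r powr \<theta> \<le> \<theta> r + 1 - \<theta>\<close>, and because the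
  numerator at \<open>X\<close> is nonnegative, every \<open>Y\<close> with \<open>f\<^sub>\<theta>(Y) \<le> f\<^sub>\<theta>(X)\<close> satisfies
  \<open>g(Y) \<le> g(X)\<close> for \<open>g(Z) = trace (Z\<^sup>T F Z + Z\<^sup>T D)\<close> (\<open>f_theta_le_imp_linearized_le\<close>).
  So a local maximizer of \<open>f\<^sub>\<theta>\<close> is a local maximizer of \<open>g\<close>, and \<open>E(X)\<close> is a positive multiple of
  \<open>N = F + (D X\<^sup>T + X D\<^sup>T) / 2\<close>.

  Now rotate one unit vector \<open>x = X q\<close> of the range of \<open>X\<close> towards a unit vector \<open>w\<close> orthogonal to
  that range, and leave the rest of the range fixed. Along this curve the first derivative of \<open>g\<close> at
  \<open>X\<close> is \<open>2 w\<^sup>T N x\<close>; when it vanishes, \<open>g\<close> has second-order term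
  \<open>t\<^sup>2 (w\<^sup>T N w - x\<^sup>T N x + q\<^sup>T X\<^sup>T D q / 2)\<close>. As \<open>X\<^sup>T D\<close> is positive semidefinite, local maximality
  gives \<open>w\<^sup>T N x = 0\<close> and \<open>w\<^sup>T N w \<le> x\<^sup>T N x\<close> for all such \<open>x\<close> and \<open>w\<close>
  (\<open>quadratic_local_maximizer_conditions\<close>). The range of \<open>X\<close> is therefore invariant under \<open>N\<close>, and
  every Rayleigh quotient on it dominates every Rayleigh quotient on its orthogonal complement.
  Diagonalizing \<open>N\<close> on the two subspaces separately then lists the eigenvalues in descending order,
  those of the range of \<open>X\<close> first (\<open>top_invariant_subspaceI\<close>).
\<close>

section \<open>Descending orthonormal eigenvectors of self-adjoint maps\<close>

text \<open>
  Otherwise, for small \<open>t\<close> of the sign of \<open>g\<close> the linear term would win. This is the first-order condition in both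
  variational arguments below: for Rayleigh quotients and for the kernel of a semidefinite form.
\<close>

lemma quadratic_dominates_linear_imp_zero:
  fixes g K :: real
  assumes "\<And>t. 2 * t * g \<le> t\<^sup>2 * K"
  shows "g = 0"
proof -
  define m where "m = 1 / (\<bar>K\<bar> + 1)"
  have m: "m > 0" "m * K \<le> 1"
    by (auto simp: m_def field_simps)
  have "2 * (m * g\<^sup>2) \<le> (m * g)\<^sup>2 * K"
    using assms[of "m * g"] by (simp add: power2_eq_square mult_ac)
  also have "\<dots> = (m * g\<^sup>2) * (m * K)"
    by (simp add: power2_eq_square)
  also have "\<dots> \<le> (m * g\<^sup>2) * 1"
    using m by (intro mult_left_mono) auto
  finally have "m * g\<^sup>2 \<le> 0"
    by simp
  then show ?thesis
    using m by (simp add: mult_le_0_iff)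
qed

text \<open>
  The residual \<open>z = f u - (u \<bullet> f u) u\<close> is orthogonal to \<open>u\<close>. Moving from \<open>u\<close> in the direction \<open>z\<close>
  cannot raise the Rayleigh quotient to first order, so \<open>z\<close> is orthogonal to \<open>f u\<close>, hence to itself.
\<close>

lemma rayleigh_maximizer_is_eigenvector:
  fixes f :: "'a::euclidean_space \<Rightarrow> 'a"
  assumes f: "linear f" and sa: "\<And>x y. x \<bullet> f y = f x \<bullet> y"
    and S: "subspace S" "f ` S \<subseteq> S"
    and u: "u \<in> S" "u \<bullet> u = 1" and max: "\<And>v. v \<in> S \<Longrightarrow> v \<bullet> f v \<le> (u \<bullet> f u) * (v \<bullet> v)"
  shows "f u = (u \<bullet> f u) *\<^sub>R u"
proof -
  define l where "l = u \<bullet> f u"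
  define z where "z = f u - l *\<^sub>R u"
  have zS: "z \<in> S"
    unfolding z_def using S u by (auto intro!: subspace_diff subspace_scale)
  have zu: "z \<bullet> u = 0"
    unfolding z_def l_def using u by (simp add: inner_simps sa)
  have "z \<bullet> f u = 0"
  proof (rule quadratic_dominates_linear_imp_zero)
    fix t :: real
    have "(u + t *\<^sub>R z) \<bullet> f (u + t *\<^sub>R z) \<le> l * ((u + t *\<^sub>R z) \<bullet> (u + t *\<^sub>R z))"
      unfolding l_def by (intro max subspace_add subspace_scale S u zS)
    then show "2 * t * (z \<bullet> f u) \<le> t\<^sup>2 * (l * (z \<bullet> z) - z \<bullet> f z)"
      using zu u sa[of u z] 
      by (simp add: linear_add[OF f] linear_scale[OF f] inner_simps inner_commute l_def[symmetric]
          power2_eq_square algebra_simps)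
  qed
  then have "z \<bullet> z = 0"
    using zu by (simp add: z_def inner_simps)
  then show ?thesis
    by (simp add: z_def l_def)
qed

lemma rayleigh_maximizer_exists:
  fixes f :: "'a::euclidean_space \<Rightarrow> 'a"
  assumes f: "linear f" and S: "subspace S" "S \<noteq> {0}"
  obtains u where "u \<in> S" "u \<bullet> u = 1" "\<And>v. v \<in> S \<Longrightarrow> v \<bullet> f v \<le> (u \<bullet> f u) * (v \<bullet> v)"
proof -
  let ?C = "S \<inter> sphere 0 1"
  have "compact ?C"
    using closed_subspace[OF S(1)] by (intro closed_Int_compact) auto
  moreover have "?C \<noteq> {}"
  proof -
    obtain v where "v \<in> S" "v \<noteq> 0"
      using S subspace_0 by blast
    then have "v /\<^sub>R norm v \<in> ?C"
      using S by (auto intro!: subspace_scale)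
    then show ?thesis by blast
  qed
  moreover have "continuous_on ?C (\<lambda>x. x \<bullet> f x)"
    using f by (intro continuous_intros linear_continuous_on) (simp add: linear_conv_bounded_linear)
  ultimately obtain u where u: "u \<in> ?C" and max: "\<And>v. v \<in> ?C \<Longrightarrow> v \<bullet> f v \<le> u \<bullet> f u"
    using continuous_attains_sup[of ?C "\<lambda>x. x \<bullet> f x"] by blast
  show thesis
  proof (rule that)
    show "u \<in> S" "u \<bullet> u = 1"
      using u by (auto simp: norm_eq_1)
    fix v assume v: "v \<in> S"
    show "v \<bullet> f v \<le> (u \<bullet> f u) * (v \<bullet> v)"
    proof (cases "v = 0")
      case False
      then have "v /\<^sub>R norm v \<in> ?C"
        using S v by (auto intro!: subspace_scale)
      from max[OF this] have "(v \<bullet> f v) / (norm v)\<^sup>2 \<le> u \<bullet> f u"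
        by (simp add: linear_scale[OF f] power2_eq_square divide_inverse mult_ac)
      with False show ?thesis
        by (simp add: field_simps dot_square_norm)
    qed (simp add: linear_0[OF f])
  qed
qed

text \<open>
  Ordering by \<open>u \<bullet> f u\<close> is ordering by eigenvalue, since the \<open>u\<close> are unit eigenvectors.
\<close>

definition desc_eigenframe :: "('a::euclidean_space \<Rightarrow> 'a) \<Rightarrow> 'a list \<Rightarrow> bool" where
  "desc_eigenframe f us \<longleftrightarrow>
     (\<forall>u\<in>set us. u \<bullet> u = 1 \<and> f u = (u \<bullet> f u) *\<^sub>R u) \<and>
     sorted_wrt (\<lambda>u v. u \<bullet> v = 0 \<and> v \<bullet> f v \<le> u \<bullet> f u) us"

text \<open>
  The spectral theorem on an invariant subspace. Splitting off a maximizer of the Rayleigh quotient on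
  \<open>S\<close> and continuing in its orthogonal complement within \<open>S\<close> produces the eigenvalues in descending order,
  because each later eigenvalue is a Rayleigh quotient on \<open>S\<close>.
\<close>

lemma desc_eigenframe_exists:
  fixes f :: "'a::euclidean_space \<Rightarrow> 'a"
  assumes f: "linear f" and sa: "\<And>x y. x \<bullet> f y = f x \<bullet> y"
    and S: "subspace S" "f ` S \<subseteq> S"
  shows "\<exists>us. desc_eigenframe f us \<and> set us \<subseteq> S \<and> length us = dim S"
  using S
proof (induction "dim S" arbitrary: S)
  case 0
  then show ?case
    by (intro exI[of _ "[]"]) (simp add: desc_eigenframe_def)
next
  case (Suc d)
  from Suc.hyps(2) have "S \<noteq> {0}" by auto
  then obtain u where u: "u \<in> S" "u \<bullet> u = 1"
    and max: "\<And>v. v \<in> S \<Longrightarrow> v \<bullet> f v \<le> (u \<bullet> f u) * (v \<bullet> v)"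
    using rayleigh_maximizer_exists[OF f Suc.prems(1)] by blast
  have eig: "f u = (u \<bullet> f u) *\<^sub>R u"
    by (rule rayleigh_maximizer_is_eigenvector[OF f sa Suc.prems u max])
  define T where "T = {y \<in> S. u \<bullet> y = 0}"
  have T: "subspace T"
    using Suc.prems(1) unfolding T_def subspace_def by (auto simp: inner_simps)
  have fT: "f ` T \<subseteq> T"
  proof
    fix y assume "y \<in> f ` T"
    then obtain x where x: "x \<in> S" "u \<bullet> x = 0" "y = f x"
      by (auto simp: T_def)
    have "u \<bullet> y = f u \<bullet> x"
      unfolding x(3) by (rule sa)
    also have "\<dots> = ((u \<bullet> f u) *\<^sub>R u) \<bullet> x"
      using eig by simp
    finally have "u \<bullet> y = 0"
      using x(2) by simp
    with x Suc.prems(2) show "y \<in> T"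
      by (auto simp: T_def)
  qed
  have Teq: "T = {y \<in> S. \<forall>x\<in>span {u}. orthogonal x y}"
    by (auto simp: T_def span_singleton orthogonal_def) 
  have "u \<noteq> 0" using u by auto
  then have "dim (span {u}) = 1"
    by simp
  moreover have "dim T + dim (span {u}) = dim S"
    unfolding Teq using Suc.prems(1) u
    by (intro dim_subspace_orthogonal_to_vectors span_minimal) auto
  ultimately have "d = dim T"
    using Suc.hyps(2) by simp
  from Suc.hyps(1)[OF this T fT] obtain us
    where us: "desc_eigenframe f us" "set us \<subseteq> T" "length us = dim T" by blast
  have "v \<bullet> f v \<le> u \<bullet> f u" if "v \<in> set us" for v
    using max[of v] that us by (auto simp: T_def desc_eigenframe_def)
  then have "desc_eigenframe f (u # us)"
    using us u eig by (auto simp: T_def desc_eigenframe_def)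
  then show ?case
    using us u \<open>d = dim T\<close> Suc.hyps(2) by (intro exI[of _ "u # us"]) (auto simp: T_def)
qed

lemma desc_eigenframe_nth:
  assumes "desc_eigenframe f us" "i < length us" "j < length us"
  shows "us ! i \<bullet> us ! j = (if i = j then 1 else 0)"
  using assms unfolding desc_eigenframe_def sorted_wrt_iff_nth_less
  by (cases i j rule: linorder_cases) (auto, metis inner_commute)

lemma desc_eigenframe_span:
  fixes us :: "'a::euclidean_space list"
  assumes us: "desc_eigenframe f us" and "set us \<subseteq> S" "length us = dim S" "subspace S"
  shows "span (set us) = S"
proof -
  have "distinct us"
    unfolding distinct_conv_nth using desc_eigenframe_nth[OF us] by (metis zero_neq_one)
  then have card: "card (set us) = dim S"
    using assms distinct_card by fastforce
  have "pairwise orthogonal (set us)"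
    unfolding pairwise_def orthogonal_def
    by (metis in_set_conv_nth desc_eigenframe_nth[OF us])
  moreover have "0 \<notin> set us"
    using us by (auto simp: desc_eigenframe_def)
  ultimately have "independent (set us)"
    by (rule pairwise_orthogonal_independent)
  with card assms show ?thesis
    by (metis card_eq_dim dim_span subset_antisym List.finite_set span_eq_iff span_mono)
qed

section \<open>Subspaces belonging to the largest eigenvalues\<close>

lemma poly_det:
  fixes A :: "real poly ^ 'n ^ 'n"
  shows "poly (det A) x = det (\<chi> i j. poly (A $ i $ j) x)"
  by (simp add: det_def poly_sum poly_prod)

lemma poly_charpoly: "poly (charpoly M) x = det (mat x - M)"
  unfolding charpoly_def poly_det
  by (intro arg_cong[where f = det]) (simp add: vec_eq_iff mat_def)

lemma inner_congruence_entry: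
  fixes M :: "real ^ 'n ^ 'n" and P :: "real ^ 'k ^ 'n"
  shows "(transpose P ** M ** P) $ i $ j = column i P \<bullet> (M *v column j P)"
proof -
  have "(transpose P ** M ** P) $ i $ j = (transpose P ** (M ** P)) $ i $ j"
    by (simp add: matrix_mul_assoc)
  also have "\<dots> = column i P \<bullet> (M *v column j P)"
    by (simp add: matrix_matrix_mult_def transpose_def column_def inner_vec_def matrix_vector_mult_def)
  finally show ?thesis .
qed

text \<open>
  Conjugating \<open>x - M\<close> by the orthogonal matrix of eigenvectors leaves a diagonal matrix. The identity is
  checked at each real \<open>x\<close>, so that only determinants of real matrices occur.
\<close>

lemma charpoly_eigenframe:
  fixes M :: "real ^ 'n ^ 'n"
  assumes us: "desc_eigenframe ((*v) M) us" and len: "length us = CARD('n)"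
  shows "charpoly M = (\<Prod>u\<leftarrow>us. [:- (u \<bullet> (M *v u)), 1:])"
proof (subst poly_eq_poly_eq_iff[symmetric], rule ext)
  fix x
  obtain b where b: "bij_betw b (UNIV :: 'n set) {..<length us}"
    using ex_bij_betw_finite_nat[OF finite[of "UNIV :: 'n set"]] by (auto simp: len atLeast0LessThan)
  then have bl: "b i < length us" and binj: "b i = b j \<longleftrightarrow> i = j" for i j
    using bij_betw_apply[OF b] bij_betw_imp_inj_on[OF b] by (auto simp: inj_eq)
  define l where "l u = u \<bullet> (M *v u)" for u
  \<comment> \<open>The columns of \<open>P\<close> are the eigenvectors, numbered by \<open>b\<close> because the index type \<open>'n\<close> has no order.\<close>
  define P :: "real ^ 'n ^ 'n" where "P = (\<chi> r j. (us ! b j) $ r)"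
  have colP: "column j P = us ! b j" for j
    by (simp add: P_def column_def vec_eq_iff)
  have on: "us ! b i \<bullet> us ! b j = (if i = j then 1 else 0)" for i j
    using desc_eigenframe_nth[OF us bl bl] by (simp add: binj)
  have eig: "M *v (us ! b j) = l (us ! b j) *\<^sub>R (us ! b j)" for j
    using us bl unfolding desc_eigenframe_def l_def by (meson nth_mem)
  have orth: "transpose P ** P = mat 1"
    using inner_congruence_entry[of P "mat 1"]
    by (simp add: vec_eq_iff colP on) (simp add: mat_def)
  have diag: "transpose P ** (mat x - M) ** P = (\<chi> i j. if i = j then x - l (us ! b i) else 0)"
  proof -
    have "mat x *v v = x *\<^sub>R v" for v :: "real ^ 'n"
      by (simp add: vec_eq_iff matrix_vector_mult_def mat_def if_distrib if_distribR sum.delta cong: if_cong)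
    note mat_x = this
    show ?thesis
      by (auto simp: vec_eq_iff mat_x inner_congruence_entry colP matrix_vector_mult_diff_rdistrib eig inner_simps on algebra_simps)
  qed
  have "det (mat x - M) = det (transpose P ** P) * det (mat x - M)"
    unfolding orth by simp
  also have "\<dots> = det (transpose P ** (mat x - M) ** P)"
    by (simp add: det_mul)
  also have "\<dots> = (\<Prod>i\<in>UNIV. x - l (us ! b i))"
    unfolding diag by (subst det_diagonal) auto
  also have "\<dots> = (\<Prod>i<length us. x - l (us ! i))"
    by (rule prod.reindex_bij_betw[OF b])
  also have "\<dots> = (\<Prod>u\<leftarrow>us. x - l u)"
    by (simp add: prod.list_conv_set_nth atLeast0LessThan)
  also have "\<dots> = poly (\<Prod>u\<leftarrow>us. [:- l u, 1:]) x"
    by (induction us) (auto simp: algebra_simps)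
  finally show "poly (charpoly M) x = poly (\<Prod>u\<leftarrow>us. [:- (u \<bullet> (M *v u)), 1:]) x"
    unfolding poly_charpoly l_def .
qed

lemma eigvals_desc_eigenframe:
  fixes M :: "real ^ 'n ^ 'n"
  assumes us: "desc_eigenframe ((*v) M) us" and len: "length us = CARD('n)"
  shows "eigvals_desc M = map (\<lambda>u. u \<bullet> (M *v u)) us"
proof -
  define ls where "ls = map (\<lambda>u. u \<bullet> (M *v u)) us"
  have "sorted_wrt (\<ge>) ls"
    using us unfolding ls_def sorted_wrt_map desc_eigenframe_def
    by (auto elim: sorted_wrt_mono_rel[rotated])
  then have sorted: "sorted (rev ls)"
    by (simp add: sorted_wrt_rev)
  have nz: "(\<Prod>u\<leftarrow>vs. [:- (u \<bullet> (M *v u)), 1:]) \<noteq> 0" for vs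
    by (auto simp: prod_list_zero_iff)
  have "proots (charpoly M) = (\<Sum>u\<leftarrow>us. proots [:- (u \<bullet> (M *v u)), 1:])"
    unfolding charpoly_eigenframe[OF assms] by (induction us) (simp_all add: proots_mult nz del: mult_pCons_left)
  also have "\<dots> = mset ls"
    unfolding ls_def by (induction us) auto
  finally have "sorted_list_of_multiset (proots (charpoly M)) = sort ls"
    by simp
  also have "\<dots> = rev ls"
    using sorted by (intro properties_for_sort) auto
  finally show ?thesis
    by (simp add: eigvals_desc_def ls_def)
qed

lemma symmetric_mat_inner:
  fixes x y :: "real ^ 'n"
  assumes "symmetric_mat M"
  shows "x \<bullet> (M *v y) = (M *v x) \<bullet> y"
proof -
  have "M *v x = x v* M"
    using assms unfolding symmetric_mat_def by (metis transpose_matrix_vector)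
  then show ?thesis by (simp add: dot_lmul_matrix)
qed

text \<open>
  Orthogonality makes \<open>V\<close> and its complement invariant under \<open>M\<close>. An eigenframe of \<open>V\<close> followed by one of
  the complement is then an eigenframe of the whole space, and it is still in descending order because
  the Rayleigh quotients on \<open>V\<close> dominate.
\<close>

lemma top_invariant_subspaceI:
  fixes M :: "real ^ 'n ^ 'n"
  assumes M: "symmetric_mat M" and V: "subspace V"
    and orth: "\<And>v w. v \<in> V \<Longrightarrow> w \<in> V\<^sup>\<bottom> \<Longrightarrow> w \<bullet> (M *v v) = 0"
    and dom: "\<And>v w. v \<in> V \<Longrightarrow> w \<in> V\<^sup>\<bottom> \<Longrightarrow> v \<bullet> v = 1 \<Longrightarrow> w \<bullet> w = 1 \<Longrightarrow> w \<bullet> (M *v w) \<le> v \<bullet> (M *v v)"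
  shows "top_invariant_subspace (dim V) M V"
proof -
  note sa = symmetric_mat_inner[OF M]
  have lin: "linear ((*v) M)" by simp
  have inv: "(*v) M ` V \<subseteq> V"
  proof -
    have "M *v v \<in> V\<^sup>\<bottom>\<^sup>\<bottom>" if "v \<in> V" for v
      using orth[OF that] by (simp add: orthogonal_comp_def[of "V\<^sup>\<bottom>"] orthogonal_def)
    then show ?thesis
      using orthogonal_comp_self[OF V] by blast
  qed
  have inv': "(*v) M ` (V\<^sup>\<bottom>) \<subseteq> V\<^sup>\<bottom>"
  proof
    fix y assume "y \<in> (*v) M ` (V\<^sup>\<bottom>)"
    then obtain w where w: "w \<in> V\<^sup>\<bottom>" "y = M *v w" by blast
    have "v \<bullet> y = 0" if "v \<in> V" for v
      using orth[OF that w(1)] sa[of v w] w(2) by (simp add: inner_commute)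
    then show "y \<in> V\<^sup>\<bottom>"
      by (simp add: orthogonal_comp_def orthogonal_def)
  qed
  have dims: "dim (V\<^sup>\<bottom>) + dim V = CARD('n)"
    using dim_subspace_orthogonal_to_vectors[of V UNIV] V
    by (simp add: orthogonal_comp_def)
  obtain us where us: "desc_eigenframe ((*v) M) us" "set us \<subseteq> V" "length us = dim V"
    using desc_eigenframe_exists[OF lin sa V inv] by blast
  obtain ws where ws: "desc_eigenframe ((*v) M) ws" "set ws \<subseteq> V\<^sup>\<bottom>" "length ws = dim (V\<^sup>\<bottom>)"
    using desc_eigenframe_exists[OF lin sa subspace_orthogonal_comp inv'] by blast
  have "u \<bullet> w = 0 \<and> w \<bullet> (M *v w) \<le> u \<bullet> (M *v u)" if "u \<in> set us" "w \<in> set ws" for u w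
    using that us ws dom[of u w]
    by (auto simp: desc_eigenframe_def orthogonal_comp_def orthogonal_def)
  then have frame: "desc_eigenframe ((*v) M) (us @ ws)"
    using us ws by (auto simp: desc_eigenframe_def sorted_wrt_append)
  have eigs: "eigvals_desc M = map (\<lambda>u. u \<bullet> (M *v u)) (us @ ws)"
    using us ws dims by (intro eigvals_desc_eigenframe[OF frame]) auto
  show ?thesis
    unfolding top_invariant_subspace_def
  proof (intro conjI exI[of _ "(!) us"] allI impI)
    show "dim V \<le> length (eigvals_desc M)"
      by (simp add: eigs us)
  next
    fix i j assume "i < dim V" "j < dim V"
    then show "us ! i \<bullet> us ! j = (if i = j then 1 else 0)"
      using desc_eigenframe_nth[OF us(1)] us(3) by simp
  next
    fix i assume "i < dim V"
    then show "M *v us ! i = eigvals_desc M ! i *\<^sub>R us ! i"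
      using us(1,3) unfolding desc_eigenframe_def eigs by (simp add: nth_append)
  next
    have "(!) us ` {..<dim V} = set us"
      using us(3) by (auto simp: set_conv_nth)
    then show "V = span ((!) us ` {..<dim V})"
      using desc_eigenframe_span[OF us V] by simp
  qed
qed

section \<open>Rotating one direction of an orthonormal frame\<close>

lemma trace_transpose_mult:
  fixes X M :: "real ^ 'k ^ 'n"
  shows "trace (transpose X ** M) = X \<bullet> M"
  unfolding trace_def matrix_matrix_mult_def transpose_def inner_vec_def
  by (simp, subst sum.swap, rule refl)

lemma f_num_inner: "f_num A D X = X \<bullet> (A ** X) + X \<bullet> D"
  by (simp add: f_num_def trace_add trace_transpose_mult flip: matrix_mul_assoc)

lemma trace_congruence_inner:
  "trace (transpose X ** B ** X) = X \<bullet> (B ** X)" for X :: "real ^ 'k ^ 'n"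
  by (simp add: trace_transpose_mult flip: matrix_mul_assoc)

text \<open>
  With this form, membership in \<open>stiefel\<close> of the low-rank updates below reduces to expanding inner products.
\<close>

lemma stiefel_iff_inner:
  fixes X :: "real ^ 'k ^ 'n"
  shows "X \<in> stiefel \<longleftrightarrow> (\<forall>p q. (X *v p) \<bullet> (X *v q) = p \<bullet> q)"
proof -
  have eq: "(X *v p) \<bullet> (X *v q) = p \<bullet> ((transpose X ** X) *v q)" for p q
    by (metis dot_lmul_matrix inner_commute matrix_vector_mul_assoc transpose_matrix_vector)
  show ?thesis
  proof
    assume "X \<in> stiefel"
    then show "\<forall>p q. (X *v p) \<bullet> (X *v q) = p \<bullet> q"
      by (simp add: eq stiefel_def)
  next
    assume "\<forall>p q. (X *v p) \<bullet> (X *v q) = p \<bullet> q"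
    then have "(transpose X ** X) *v q = q" for q
      unfolding eq by (metis vector_eq_rdot inner_commute)
    then show "X \<in> stiefel"
      by (simp add: stiefel_def matrix_eq)
  qed
qed

definition outer :: "real ^ 'n \<Rightarrow> real ^ 'k \<Rightarrow> real ^ 'k ^ 'n" where
  "outer y q = (\<chi> i. (y $ i) *\<^sub>R q)"

lemma inner_outer: "M \<bullet> outer y q = y \<bullet> (M *v q)"
  by (simp add: outer_def inner_vec_def matrix_vector_mult_def sum_distrib_left mult_ac)

lemma outer_inner: "outer y q \<bullet> M = y \<bullet> (M *v q)"
  by (simp add: inner_commute[of "outer y q"] inner_outer)

lemma matrix_mult_outer: "A ** outer y q = outer (A *v y) q"
  by (simp add: outer_def vec_eq_iff matrix_matrix_mult_def matrix_vector_mult_def sum_distrib_left mult_ac)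

lemma outer_mult_vec: "outer y q *v p = (q \<bullet> p) *\<^sub>R y"
  by (simp add: outer_def vec_eq_iff inner_vec_def matrix_vector_mult_def sum_distrib_left mult_ac)

lemma outer_scale_add: "outer (a *\<^sub>R y + b *\<^sub>R z) q = a *\<^sub>R outer y q + b *\<^sub>R outer z q"
  by (simp add: outer_def vec_eq_iff algebra_simps)

text \<open>
  For \<open>X\<close> in \<open>stiefel\<close>, a unit vector \<open>q\<close> and a unit vector \<open>w\<close> orthogonal to the range of \<open>X\<close>, this curve sends
  \<open>q\<close> to \<open>cos t X q + sin t w\<close> and agrees with \<open>X\<close> on the vectors orthogonal to \<open>q\<close>.
\<close>

definition rotate_frame :: "real ^ 'k ^ 'n \<Rightarrow> real ^ 'k \<Rightarrow> real ^ 'n \<Rightarrow> real \<Rightarrow> real ^ 'k ^ 'n" where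
  "rotate_frame X q w t = X + outer ((cos t - 1) *\<^sub>R (X *v q) + sin t *\<^sub>R w) q"

lemma rotate_frame_0: "rotate_frame X q w 0 = X"
  by (simp add: rotate_frame_def outer_def vec_eq_iff)

lemma continuous_rotate_frame: "isCont (rotate_frame X q w) t"
  unfolding rotate_frame_def outer_scale_add by (intro continuous_intros)

lemma rotate_frame_in_stiefel:
  assumes X: "X \<in> stiefel" and q: "q \<bullet> q = 1" and w: "w \<bullet> w = 1"
    and wX: "\<And>p. w \<bullet> (X *v p) = 0"
  shows "rotate_frame X q w t \<in> stiefel"
  unfolding stiefel_iff_inner
proof (intro allI)
  fix p r
  define c where "c = cos t"
  define s where "s = sin t"
  have s2: "s * s = 1 - c * c"
    unfolding c_def s_def using sin_cos_squared_add[of t] by (simp add: power2_eq_square)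
  have XX: "(X *v p) \<bullet> (X *v q) = p \<bullet> q" for p q
    using X by (simp add: stiefel_iff_inner)
  have Xw: "(X *v p) \<bullet> w = 0" for p
    using wX by (simp add: inner_commute)
  define y where "y = (c - 1) *\<^sub>R (X *v q) + s *\<^sub>R w"
  have Xy: "(X *v p) \<bullet> y = (c - 1) * (p \<bullet> q)" for p
    by (simp add: y_def inner_simps XX Xw)
  have yy: "y \<bullet> y = 2 - 2 * c"
    by (simp add: y_def inner_simps XX Xw wX q w algebra_simps s2)
  have "rotate_frame X q w t *v p = X *v p + (q \<bullet> p) *\<^sub>R y" for p
    by (simp add: rotate_frame_def y_def c_def s_def matrix_vector_mult_add_rdistrib outer_mult_vec)
  then have "(rotate_frame X q w t *v p) \<bullet> (rotate_frame X q w t *v r) =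
      (X *v p) \<bullet> (X *v r) + (q \<bullet> r) * ((X *v p) \<bullet> y) + (q \<bullet> p) * ((X *v r) \<bullet> y)
        + (q \<bullet> p) * (q \<bullet> r) * (y \<bullet> y)"
    by (simp add: inner_add_left inner_add_right inner_commute[of y "X *v r"] algebra_simps)
  also have "\<dots> = p \<bullet> r"
    unfolding XX Xy yy inner_commute[of _ q] by (simp add: algebra_simps)
  finally show "(rotate_frame X q w t *v p) \<bullet> (rotate_frame X q w t *v r) = p \<bullet> r" .
qed

lemma f_num_rotate_frame:
  assumes F: "symmetric_mat F" and q: "q \<bullet> q = 1" and x: "x = X *v q"
  shows "f_num F D (rotate_frame X q w t) - f_num F D X = (sin t)\<^sup>2 * (w \<bullet> (F *v w) - x \<bullet> (F *v x))
           + 2 * sin t * cos t * (w \<bullet> (F *v x)) + sin t * (w \<bullet> (D *v q)) - (1 - cos t) * (x \<bullet> (D *v q))"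
proof -
  define a where "a = cos t - 1"
  define y where "y = a *\<^sub>R x + sin t *\<^sub>R w"
  have a2: "a * a + 2 * a = - (sin t * sin t)"
    using sin_cos_squared_add[of t] by (simp add: a_def power2_eq_square algebra_simps)
  note sa = symmetric_mat_inner[OF F]
  have "(F ** X) *v q = F *v x"
    by (simp add: x matrix_vector_mul_assoc)
  then have "f_num F D (rotate_frame X q w t) = f_num F D X + 2 * (y \<bullet> (F *v x)) + y \<bullet> (F *v y) + y \<bullet> (D *v q)"
    unfolding f_num_inner rotate_frame_def x[symmetric] y_def[symmetric] a_def[symmetric]
    by (simp add: matrix_add_ldistrib inner_add_left inner_add_right inner_outer outer_inner matrix_mult_outer
        matrix_vector_mult_add_rdistrib outer_mult_vec q sa[symmetric] x[symmetric])
  moreover have "2 * (y \<bullet> (F *v x)) + y \<bullet> (F *v y) =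
      (sin t)\<^sup>2 * (w \<bullet> (F *v w) - x \<bullet> (F *v x)) + 2 * sin t * cos t * (w \<bullet> (F *v x))"
  proof -
    have "x \<bullet> (F *v w) = w \<bullet> (F *v x)"
      using sa[of x w] by (simp only: inner_commute)
    then have "2 * (y \<bullet> (F *v x)) + y \<bullet> (F *v y) = (a * a + 2 * a) * (x \<bullet> (F *v x))
        + 2 * sin t * (a + 1) * (w \<bullet> (F *v x)) + sin t * sin t * (w \<bullet> (F *v w))"
      unfolding y_def by (simp add: matrix_vector_right_distrib matrix_vector_mult_scaleR
          inner_add_left inner_add_right algebra_simps)
    then show ?thesis
      unfolding a2 by (simp add: a_def power2_eq_square algebra_simps)
  qed
  moreover have "y \<bullet> (D *v q) = sin t * (w \<bullet> (D *v q)) - (1 - cos t) * (x \<bullet> (D *v q))"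
    by (simp add: y_def a_def inner_add_left algebra_simps)
  ultimately show ?thesis by simp
qed

text \<open>
  The first-order condition \<open>2 g + e = 0\<close> turns \<open>h t\<close> into
  \<open>(1 - cos t) ((1 + cos t) p + e sin t - d)\<close>, so the second-order condition is the sign of the limit of the
  second factor.
\<close>

lemma trig_local_max_conditions:
  fixes p g e d :: real
  defines "h \<equiv> \<lambda>t. (sin t)\<^sup>2 * p + 2 * sin t * cos t * g + sin t * e - (1 - cos t) * d"
  assumes le: "eventually (\<lambda>t. h t \<le> 0) (nhds 0)"
  shows "2 * g + e = 0" "2 * p \<le> d"
proof -
  obtain r where r: "r > 0" "\<And>t. \<bar>t\<bar> < r \<Longrightarrow> h t \<le> 0"
    using le unfolding eventually_nhds_metric by (auto simp: dist_real_def)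
  have "(h has_real_derivative (2 * g + e)) (at 0)"
    unfolding h_def by (auto intro!: derivative_eq_intros)
  moreover have "\<forall>t. \<bar>0 - t\<bar> < r \<longrightarrow> h t \<le> h 0"
    using r by (auto simp: h_def)
  ultimately show e: "2 * g + e = 0"
    using r(1) DERIV_local_max by blast
  have "eventually (\<lambda>t. (1 + cos t) * p + e * sin t \<le> d) (at_right 0)"
  proof (rule eventually_at_rightI)
    show "0 < min r pi" using r(1) by simp
    fix t assume t: "t \<in> {0<..<min r pi}"
    then have pos: "1 - cos t > 0"
      using cos_monotone_0_pi[of 0 t] by simp
    have "2 * g = - e" using e by simp
    then have "sin t * cos t * (2 * g) = - sin t * cos t * e" by simp
    then have "h t = (1 - cos t) * ((1 + cos t) * p + e * sin t - d)"
      unfolding h_def sin_squared_eq by (simp add: power2_eq_square algebra_simps)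
    moreover have "h t \<le> 0" using t r by auto
    ultimately show "(1 + cos t) * p + e * sin t \<le> d"
      using pos by (simp add: mult_le_0_iff)
  qed
  moreover have "((\<lambda>t. (1 + cos t) * p + e * sin t) \<longlongrightarrow> (1 + cos 0) * p + e * sin 0) (at_right (0::real))"
    by (intro tendsto_intros)
  ultimately have "(1 + cos 0) * p + e * sin 0 \<le> d"
    by (intro tendsto_upperbound) auto
  then show "2 * p \<le> d" by simp
qed

text \<open>
  Rotating \<open>X q\<close> towards \<open>w\<close> gives \<open>2 (w \<bullet> N w - x \<bullet> N x) + d \<le> 0\<close> with \<open>x = X q\<close> and
  \<open>d = q \<bullet> (X\<^sup>T D) q\<close>; semidefiniteness of \<open>X\<^sup>T D\<close> lets \<open>d\<close> be dropped. The matrix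
  \<open>(D X\<^sup>T + X D\<^sup>T) / 2\<close> contributes \<open>w \<bullet> D q / 2\<close> to \<open>w \<bullet> N x\<close>, nothing to \<open>w \<bullet> N w\<close> and \<open>d\<close> to \<open>x \<bullet> N x\<close>.
\<close>

lemma quadratic_local_maximizer_conditions:
  fixes X D :: "real ^ 'k ^ 'n" and F :: "real ^ 'n ^ 'n"
  defines "N \<equiv> F + (1 / 2) *\<^sub>R (D ** transpose X + X ** transpose D)"
  assumes max: "local_maximizer_on (f_num F D) stiefel X" and F: "symmetric_mat F"
    and XD: "psd (transpose X ** D)"
    and q: "q \<bullet> q = 1" and w: "w \<bullet> w = 1" "\<And>p. w \<bullet> (X *v p) = 0"
  shows "w \<bullet> (N *v (X *v q)) = 0" "w \<bullet> (N *v w) \<le> (X *v q) \<bullet> (N *v (X *v q))"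
proof -
  define x where "x = X *v q"
  have X: "X \<in> stiefel"
    using max by (simp add: local_maximizer_on_def)
  obtain \<epsilon> where eps: "\<epsilon> > 0" "\<And>Y. Y \<in> stiefel \<Longrightarrow> dist Y X < \<epsilon> \<Longrightarrow> f_num F D Y \<le> f_num F D X"
    using max unfolding local_maximizer_on_def by blast
  have "(rotate_frame X q w \<longlongrightarrow> rotate_frame X q w 0) (nhds 0)"
    using continuous_rotate_frame[of 0 X q w] by (simp add: tendsto_at_iff_tendsto_nhds isCont_def)
  then have "eventually (\<lambda>t. dist (rotate_frame X q w t) X < \<epsilon>) (nhds 0)"
    unfolding rotate_frame_0 using eps(1) by (rule tendstoD)
  then have "eventually (\<lambda>t. f_num F D (rotate_frame X q w t) \<le> f_num F D X) (nhds 0)"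
    by (rule eventually_mono) (intro eps(2) rotate_frame_in_stiefel X q w)
  then have ev: "eventually (\<lambda>t. (sin t)\<^sup>2 * (w \<bullet> (F *v w) - x \<bullet> (F *v x))
      + 2 * sin t * cos t * (w \<bullet> (F *v x)) + sin t * (w \<bullet> (D *v q))
      - (1 - cos t) * (x \<bullet> (D *v q)) \<le> 0) (nhds 0)"
    unfolding f_num_rotate_frame[OF F q x_def, symmetric] by simp
  note conds = trig_local_max_conditions[OF ev]
  have d: "0 \<le> x \<bullet> (D *v q)"
  proof -
    have "0 \<le> q \<bullet> ((transpose X ** D) *v q)"
      using XD by (simp add: psd_def)
    also have "\<dots> = ((D *v q) v* X) \<bullet> q"
      unfolding matrix_vector_mul_assoc[symmetric] transpose_matrix_vector by (rule inner_commute)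
    also have "\<dots> = x \<bullet> (D *v q)"
      unfolding x_def dot_lmul_matrix by (rule inner_commute)
    finally show ?thesis .
  qed
  have xX: "x v* X = q"
    using X unfolding x_def stiefel_def
    by (metis (mono_tags) matrix_vector_mul_assoc matrix_vector_mul_lid mem_Collect_eq transpose_matrix_vector)
  have wX: "w v* X = 0"
    by (metis dot_lmul_matrix inner_eq_zero_iff w(2))
  have N: "u \<bullet> (N *v v) = u \<bullet> (F *v v) + (u \<bullet> (D *v (v v* X)) + (u v* X) \<bullet> (v v* D)) / 2" for u v
    by (simp add: N_def matrix_vector_mult_add_rdistrib scaleR_matrix_vector_assoc[symmetric] inner_simps 
        matrix_vector_mul_assoc[symmetric] dot_lmul_matrix)
  have qx: "q \<bullet> (x v* D) = x \<bullet> (D *v q)"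
    by (simp add: inner_commute[of q] dot_lmul_matrix)
  show "w \<bullet> (N *v (X *v q)) = 0"
    using conds(1) by (simp add: N x_def[symmetric] xX wX)
  show "w \<bullet> (N *v w) \<le> (X *v q) \<bullet> (N *v (X *v q))"
    using conds(2) d by (simp add: N x_def[symmetric] xX wX qx)
qed

section \<open>Replacing the quotient by a quadratic function\<close>

text \<open>
  Otherwise moving from \<open>v\<close> in the direction \<open>- B v\<close> would make the form negative.
\<close>

lemma psd_inner_zero_imp:
  assumes B: "psd B" and v: "v \<bullet> (B *v v) = 0"
  shows "B *v v = 0"
proof -
  have sym: "symmetric_mat B" using B by (simp add: psd_def)
  have "- ((B *v v) \<bullet> (B *v v)) = 0"
  proof (rule quadratic_dominates_linear_imp_zero)
    fix t :: real
    define z where "z = B *v v"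
    have "v \<bullet> (B *v z) = z \<bullet> z"
      unfolding z_def by (rule symmetric_mat_inner[OF sym])
    moreover have "0 \<le> (v + t *\<^sub>R z) \<bullet> (B *v (v + t *\<^sub>R z))"
      using B by (simp add: psd_def)
    ultimately have "0 \<le> 2 * t * (z \<bullet> z) + t\<^sup>2 * (z \<bullet> (B *v z))"
      using v by (simp add: matrix_vector_right_distrib matrix_vector_mult_scaleR
          inner_add_left inner_add_right z_def[symmetric] power2_eq_square algebra_simps)
    then show "2 * t * - ((B *v v) \<bullet> (B *v v)) \<le> t\<^sup>2 * (z \<bullet> (B *v z))"
      by (simp add: z_def)
  qed
  then show ?thesis by simp
qed

lemma inner_columns:
  fixes X Y :: "real ^ 'k ^ 'n"
  shows "X \<bullet> Y = (\<Sum>j\<in>UNIV. column j X \<bullet> column j Y)"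
  unfolding inner_vec_def column_def by (simp, rule sum.swap)

lemma column_matrix_mult: "column j (B ** X) = B *v column j X"
  by (simp add: vec_eq_iff column_def matrix_matrix_mult_def matrix_vector_mult_def)

lemma dim_range_stiefel:
  fixes X :: "real ^ 'k ^ 'n"
  assumes "X \<in> stiefel"
  shows "dim (range ((*v) X)) = CARD('k)"
proof -
  have "inj ((*v) X)"
    using assms unfolding stiefel_def
    by (intro inj_on_inverseI[of _ "(*v) (transpose X)"])
      (simp add: matrix_vector_mul_assoc del: transpose_matrix_vector)
  then have "dim (range ((*v) X)) = dim (UNIV :: (real ^ 'k) set)"
    by (intro dim_image_eq) (auto simp: span_UNIV)
  then show ?thesis by simp
qed

text \<open>
  If the trace vanished, every column of \<open>X\<close> would lie in the kernel of \<open>B\<close>. The range of the symmetric matrix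
  \<open>B\<close> would then be orthogonal to the \<open>k\<close>-dimensional range of \<open>X\<close>, against the rank condition.
\<close>

lemma trace_congruence_pos:
  fixes X :: "real ^ 'k ^ 'n"
  assumes B: "psd B" and rank: "rank B > CARD('n) - CARD('k)" and X: "X \<in> stiefel"
  shows "0 < trace (transpose X ** B ** X)"
proof (rule ccontr)
  assume neg: "\<not> ?thesis"
  have eq: "trace (transpose X ** B ** X) = (\<Sum>j\<in>UNIV. column j X \<bullet> (B *v column j X))"
    by (simp add: trace_congruence_inner inner_columns column_matrix_mult)
  have nn: "0 \<le> column j X \<bullet> (B *v column j X)" for j
    using B by (simp add: psd_def)
  have "(\<Sum>j\<in>UNIV. column j X \<bullet> (B *v column j X)) = 0"
    using neg unfolding eq by (intro antisym sum_nonneg nn) simp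
  then have "column j X \<bullet> (B *v column j X) = 0" for j
    using nn by (simp add: sum_nonneg_eq_0_iff)
  then have "column j (B ** X) = 0" for j
    unfolding column_matrix_mult by (rule psd_inner_zero_imp[OF B])
  then have BX: "B ** X = 0"
    by (simp add: vec_eq_iff column_def)
  let ?R = "range ((*v) X)"
  have sub: "subspace ?R" by (intro linear_subspace_image) auto
  have "x \<bullet> (B *v y) = 0" if x: "x \<in> ?R" for x y
  proof -
    obtain p where "x = X *v p" using x by blast
    then have "B *v x = 0"
      by (simp add: matrix_vector_mul_assoc BX)
    then show ?thesis
      using B by (simp add: psd_def symmetric_mat_inner)
  qed
  then have "range ((*v) B) \<subseteq> {y \<in> UNIV. \<forall>x\<in>?R. orthogonal x y}"
    by (auto simp: orthogonal_def)
  then have "rank B \<le> dim {y \<in> UNIV. \<forall>x\<in>?R. orthogonal x y}"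
    unfolding rank_dim_range by (rule dim_subset)
  also have "\<dots> + CARD('k) = CARD('n)"
    using dim_subspace_orthogonal_to_vectors[OF sub subspace_UNIV] dim_range_stiefel[OF X] by simp
  finally show False using rank by linarith
qed

text \<open>
  By concavity, the power of the denominator lies below its tangent at \<open>X\<close>; Young's inequality for
  \<open>r = trace (Y\<^sup>T B Y) / trace (X\<^sup>T B X)\<close> states this. Multiplying by the numerator at \<open>X\<close> is where its
  sign matters.
\<close>

lemma f_theta_le_imp_linearized_le:
  fixes X Y :: "real ^ 'k ^ 'n"
  assumes \<theta>: "0 \<le> \<theta>" "\<theta> \<le> 1"
    and bX: "0 < trace (transpose X ** B ** X)" and bY: "0 < trace (transpose Y ** B ** Y)"
    and num: "0 \<le> f_num A D X" and le: "f_theta \<theta> A B D Y \<le> f_theta \<theta> A B D X"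
  defines "F \<equiv> A - (\<theta> * f_one A B D X) *\<^sub>R B"
  shows "f_num F D Y \<le> f_num F D X"
proof -
  define b where "b Z = trace (transpose Z ** B ** Z)" for Z :: "real ^ 'k ^ 'n"
  define r where "r = b Y / b X"
  have r: "r > 0" using bX bY by (simp add: r_def b_def)
  have FZ: "F ** Z = A ** Z - (\<theta> * f_one A B D X) *\<^sub>R (B ** Z)" for Z :: "real ^ 'k ^ 'n"
    by (simp add: F_def vec_eq_iff matrix_matrix_mult_def sum_subtractf sum_distrib_left algebra_simps)
  have F: "f_num F D Z = f_num A D Z - \<theta> * f_one A B D X * b Z" for Z
    by (simp add: f_num_inner b_def trace_congruence_inner FZ inner_diff_right)
  have "f_num A D Y \<le> f_num A D X * (b Y powr \<theta> / b X powr \<theta>)"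
    using le bX bY unfolding f_theta_def b_def[symmetric] by (simp add: field_simps)
  also have "b Y powr \<theta> / b X powr \<theta> = r powr \<theta> * 1 powr (1 - \<theta>)"
    using bX bY by (simp add: r_def b_def powr_divide)
  also have "f_num A D X * \<dots> \<le> f_num A D X * (\<theta> * r + (1 - \<theta>) * 1)"
    using \<theta> r num by (intro mult_left_mono Youngs_inequality_0) auto
  also have "\<dots> = f_num A D X - \<theta> * f_one A B D X * b X + \<theta> * f_one A B D X * b Y"
    using bX by (simp add: f_one_def r_def b_def field_simps)
  finally show ?thesis
    unfolding F by simp
qed

section \<open>Global maximizers and orthogonal changes of basis\<close>

lemma reflection_in_stiefel:
  fixes v :: "real ^ 'k"
  assumes v: "v \<noteq> 0"
  shows "mat 1 + outer ((- 2 / (v \<bullet> v)) *\<^sub>R v) v \<in> stiefel"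
  unfolding stiefel_iff_inner
proof (intro allI)
  fix p q
  define u where "u = (- 2 / (v \<bullet> v)) *\<^sub>R v"
  have uv: "u \<bullet> p = - 2 / (v \<bullet> v) * (v \<bullet> p)" for p by (simp add: u_def)
  have "u \<bullet> u = 4 / (v \<bullet> v)"
    using v by (simp add: u_def)
  then have "((mat 1 + outer u v) *v p) \<bullet> ((mat 1 + outer u v) *v q) =
    p \<bullet> q + (v \<bullet> q) * (u \<bullet> p) + (v \<bullet> p) * (u \<bullet> q) + (v \<bullet> p) * (v \<bullet> q) * (4 / (v \<bullet> v))"
    by (simp add: matrix_vector_mult_add_rdistrib outer_mult_vec inner_add_left inner_add_right
        inner_commute[of p u] algebra_simps)
  then show "((mat 1 + outer u v) *v p) \<bullet> ((mat 1 + outer u v) *v q) = p \<bullet> q"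
    by (simp add: uv)
qed

text \<open>
  The matrix sends \<open>u\<close> to \<open>c u + s v\<close> and \<open>v\<close> to \<open>c v - s u\<close>, and it fixes the vectors orthogonal to both.
\<close>

lemma plane_rotation_in_stiefel:
  fixes u v :: "real ^ 'k"
  assumes uv: "u \<bullet> u = 1" "v \<bullet> v = 1" "u \<bullet> v = 0" and cs: "c * c + s * s = 1"
  shows "mat 1 + outer ((c - 1) *\<^sub>R u + s *\<^sub>R v) u + outer ((c - 1) *\<^sub>R v - s *\<^sub>R u) v \<in> stiefel"
  unfolding stiefel_iff_inner
proof (intro allI)
  fix p q
  define y where "y = (c - 1) *\<^sub>R u + s *\<^sub>R v"
  define z where "z = (c - 1) *\<^sub>R v - s *\<^sub>R u"
  have vu: "v \<bullet> u = 0" using uv(3) by (simp add: inner_commute)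
  have s2: "s * s = 1 - c * c" using cs by simp
  have yz: "y \<bullet> y = 2 - 2 * c" "z \<bullet> z = 2 - 2 * c" "y \<bullet> z = 0" "z \<bullet> y = 0"
    unfolding y_def z_def
    by (simp_all add: inner_add_left inner_add_right inner_diff_left inner_diff_right uv vu s2 algebra_simps)
  have py: "p \<bullet> y = (c - 1) * (u \<bullet> p) + s * (v \<bullet> p)" "p \<bullet> z = (c - 1) * (v \<bullet> p) - s * (u \<bullet> p)" for p
    by (simp_all add: y_def z_def inner_add_right inner_diff_right inner_commute[of p u] inner_commute[of p v])
  have "((mat 1 + outer y u + outer z v) *v p) \<bullet> ((mat 1 + outer y u + outer z v) *v q) =
    p \<bullet> q + (u \<bullet> q) * (p \<bullet> y) + (v \<bullet> q) * (p \<bullet> z) + (u \<bullet> p) * (q \<bullet> y) + (v \<bullet> p) * (q \<bullet> z)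
    + (u \<bullet> p) * (u \<bullet> q) * (y \<bullet> y) + (v \<bullet> p) * (v \<bullet> q) * (z \<bullet> z)"
    by (simp add: matrix_vector_mult_add_rdistrib outer_mult_vec inner_add_left inner_add_right
      inner_commute[of y q] inner_commute[of z q] yz(3,4) algebra_simps)
  also have "\<dots> = p \<bullet> q"
    unfolding yz unfolding py by (simp add: algebra_simps)
  finally show "((mat 1 + outer y u + outer z v) *v p) \<bullet> ((mat 1 + outer y u + outer z v) *v q) = p \<bullet> q" .
qed

text \<open>
  The reflection in the hyperplane orthogonal to \<open>v\<close> changes \<open>trace (Q\<^sup>T M)\<close> by
  \<open>- 2 (v \<bullet> M v) / (v \<bullet> v)\<close>. A rotation in the plane of two coordinates replaces the contribution \<open>a\<close> of that
  plane by \<open>c a + s b\<close>, where \<open>b\<close> is the difference of the two off-diagonal entries; its maximum is \<open>sqrt (a\<^sup>2 + b\<^sup>2)\<close>, so \<open>b = 0\<close>.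
\<close>

lemma psd_of_trace_maximal:
  fixes M :: "real ^ 'k ^ 'k"
  assumes max: "\<And>Q :: real ^ 'k ^ 'k. Q \<in> stiefel \<Longrightarrow> Q \<bullet> M \<le> mat 1 \<bullet> M"
  shows "psd M"
proof -
  have nonneg: "0 \<le> v \<bullet> (M *v v)" for v
  proof (cases "v = 0")
    case False
    from max[OF reflection_in_stiefel[OF this]]
    have "(v \<bullet> (M *v v)) * (2 / (v \<bullet> v)) \<ge> 0"
      by (simp add: inner_add_left outer_inner mult_ac)
    moreover have "v \<bullet> v > 0" using False by simp
    ultimately show ?thesis
      by (simp add: zero_le_divide_iff)
  qed simp
  have swap: "M $ i $ j = M $ j $ i" if "i \<noteq> j" for i j
  proof -
    define u v :: "real ^ 'k" where "u = axis i 1" and "v = axis j 1"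
    have uv: "u \<bullet> u = 1" "v \<bullet> v = 1" "u \<bullet> v = 0"
      using that by (simp_all add: u_def v_def inner_axis_axis)
    define a where "a = u \<bullet> (M *v u) + v \<bullet> (M *v v)"
    define b where "b = v \<bullet> (M *v u) - u \<bullet> (M *v v)"
    have turn_le: "c * a + s * b \<le> a" if "c * c + s * s = 1" for c s
      using max[OF plane_rotation_in_stiefel[OF uv that]]
      by (simp add: a_def b_def inner_add_left inner_diff_left outer_inner algebra_simps)
    define r where "r = sqrt (a\<^sup>2 + b\<^sup>2)"
    have "b = 0"
    proof (rule ccontr)
      assume b: "b \<noteq> 0"
      then have r: "r > 0" "r > a" "r * r = a * a + b * b"
        unfolding r_def by (auto simp: sum_power2_gt_zero_iff power2_eq_square[symmetric] intro!: real_less_rsqrt)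
      \<comment> \<open>The best rotation has \<open>(c, s)\<close> parallel to \<open>(a, b)\<close>, and it gains \<open>r - a\<close>.\<close>
      have "(a / r) * (a / r) + (b / r) * (b / r) = (a * a + b * b) / (r * r)"
        by (simp add: add_divide_distrib)
      also have "\<dots> = 1"
        using r(1) by (simp flip: r(3))
      finally have unit: "(a / r) * (a / r) + (b / r) * (b / r) = 1" .
      have "r = (a * a + b * b) / r"
        using r(1) by (simp flip: r(3))
      also have "\<dots> = (a / r) * a + (b / r) * b"
        by (simp add: add_divide_distrib)
      also have "\<dots> \<le> a"
        by (rule turn_le[OF unit])
      finally show False using r(2) by linarith
    qed
    then show ?thesis
      by (simp add: b_def u_def v_def matrix_vector_mul_component inner_axis' matrix_vector_mult_basis column_def)
  qed
  then have "transpose M = M"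
    by (simp add: vec_eq_iff transpose_def) metis
  with nonneg show ?thesis
    by (simp add: psd_def symmetric_mat_def)
qed

lemma trace_congruence_right_orthogonal:
  fixes X :: "real ^ 'k ^ 'n" and Q :: "real ^ 'k ^ 'k"
  assumes "Q \<in> stiefel"
  shows "trace (transpose (X ** Q) ** A ** (X ** Q)) = trace (transpose X ** A ** X)"
proof -
  have "Q ** transpose Q = mat 1"
    using assms by (simp add: stiefel_def matrix_left_right_inverse)
  then have "trace (transpose X ** A ** X) = trace ((transpose X ** A ** X) ** (Q ** transpose Q))"
    by simp
  also have "\<dots> = trace (((transpose X ** A ** X) ** Q) ** transpose Q)"
    by (simp only: matrix_mul_assoc)
  also have "\<dots> = trace (transpose Q ** ((transpose X ** A ** X) ** Q))"
    by (rule trace_mul_sym)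
  also have "\<dots> = trace (transpose (X ** Q) ** A ** (X ** Q))"
    by (simp only: matrix_transpose_mul matrix_mul_assoc)
  finally show ?thesis by simp
qed

lemma stiefel_mult_right:
  fixes X :: "real ^ 'k ^ 'n" and Q :: "real ^ 'k ^ 'k"
  assumes "X \<in> stiefel" "Q \<in> stiefel"
  shows "X ** Q \<in> stiefel"
  using assms unfolding stiefel_iff_inner by (simp add: matrix_vector_mul_assoc[symmetric])

lemma psd_of_global_maximizer:
  fixes X :: "real ^ 'k ^ 'n"
  assumes max: "global_maximizer_on (f_theta \<theta> A B D) stiefel X"
    and bX: "0 < trace (transpose X ** B ** X)"
  shows "psd (transpose X ** D)"
proof (rule psd_of_trace_maximal)
  fix Q :: "real ^ 'k ^ 'k" assume Q: "Q \<in> stiefel"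
  have X: "X \<in> stiefel" using max by (simp add: global_maximizer_on_def)
  have "f_theta \<theta> A B D (X ** Q) \<le> f_theta \<theta> A B D X"
    using max stiefel_mult_right[OF X Q] by (simp add: global_maximizer_on_def)
  then have "f_num A D (X ** Q) \<le> f_num A D X"
    using bX by (simp add: f_theta_def trace_congruence_right_orthogonal[OF Q] divide_le_cancel)
  then have "trace (transpose (X ** Q) ** D) \<le> trace (transpose X ** D)"
    by (simp add: f_num_def trace_add trace_congruence_right_orthogonal[OF Q])
  moreover have "trace (transpose (X ** Q) ** D) = Q \<bullet> (transpose X ** D)"
    by (simp only: matrix_transpose_mul trace_transpose_mult[symmetric] matrix_mul_assoc)
  moreover have "trace (transpose X ** D) = mat 1 \<bullet> (transpose X ** D)"
    using trace_transpose_mult[of "mat 1" "transpose X ** D"] by simp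
  ultimately show "Q \<bullet> (transpose X ** D) \<le> mat 1 \<bullet> (transpose X ** D)" by simp
qed

section \<open>Local maximizers and the largest eigenvalues\<close>

lemma local_maximizer_on_linearized:
  fixes X :: "real ^ 'k ^ 'n"
  assumes "psd B" "rank B > CARD('n) - CARD('k)" "0 \<le> \<theta>" "\<theta> \<le> 1" "0 \<le> f_num A D X"
    and "local_maximizer_on (f_theta \<theta> A B D) stiefel X"
  shows "local_maximizer_on (f_num (A - (\<theta> * f_one A B D X) *\<^sub>R B) D) stiefel X"
  using assms f_theta_le_imp_linearized_le trace_congruence_pos
  unfolding local_maximizer_on_def by metis

lemma span_columns_eq_range: "span (columns X) = range ((*v) X)" for X :: "real ^ 'k ^ 'n"
proof
  show "range ((*v) X) \<subseteq> span (columns X)"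
    using matrix_vector_mult_in_columnspace by blast
  have "column i X \<in> range ((*v) X)" for i
    by (metis matrix_vector_mult_basis rangeI)
  then show "span (columns X) \<subseteq> range ((*v) X)"
    by (intro span_minimal linear_subspace_image) (auto simp: columns_def)
qed

theorem theorem2p4:
  fixes A B :: "real ^ 'n ^ 'n" and D X\<^sub>o\<^sub>p\<^sub>t :: "real ^ 'k ^ 'n" and \<theta> :: real
  assumes "CARD('k) < CARD('n)"
    and "symmetric_mat A"
    and "psd B"
    and "rank B > CARD('n) - CARD('k)"
    and "0 \<le> \<theta>" and "\<theta> \<le> 1"
    and "local_maximizer_on (f_theta \<theta> A B D) stiefel X\<^sub>o\<^sub>p\<^sub>t \<or>
         global_maximizer_on (f_theta \<theta> A B D) stiefel X\<^sub>o\<^sub>p\<^sub>t"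
  shows "(global_maximizer_on (f_theta \<theta> A B D) stiefel X\<^sub>o\<^sub>p\<^sub>t \<longrightarrow>
            psd (transpose X\<^sub>o\<^sub>p\<^sub>t ** D)) \<and>
         (psd (transpose X\<^sub>o\<^sub>p\<^sub>t ** D) \<and>
          0 \<le> trace (transpose X\<^sub>o\<^sub>p\<^sub>t ** A ** X\<^sub>o\<^sub>p\<^sub>t + transpose X\<^sub>o\<^sub>p\<^sub>t ** D) \<longrightarrow>
            (\<exists>V. top_invariant_subspace CARD('k) (E_mat \<theta> A B D X\<^sub>o\<^sub>p\<^sub>t) V \<and>
                 orthonormal_basis_matrix X\<^sub>o\<^sub>p\<^sub>t V))"
proof (intro conjI impI)
  let ?X = "X\<^sub>o\<^sub>p\<^sub>t"
  have loc: "local_maximizer_on (f_theta \<theta> A B D) stiefel ?X"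
    using assms(7) unfolding local_maximizer_on_def global_maximizer_on_def by (auto intro: exI[of _ 1])
  then have X: "?X \<in> stiefel" by (simp add: local_maximizer_on_def)
  have pos: "0 < trace (transpose ?X ** B ** ?X)"
    by (rule trace_congruence_pos[OF assms(3,4) X])
  show "psd (transpose ?X ** D)" if "global_maximizer_on (f_theta \<theta> A B D) stiefel ?X"
    using that pos by (rule psd_of_global_maximizer)
  assume "psd (transpose ?X ** D) \<and> 0 \<le> trace (transpose ?X ** A ** ?X + transpose ?X ** D)"
  then have XD: "psd (transpose ?X ** D)" and num: "0 \<le> f_num A D ?X"
    by (simp_all add: f_num_def)
  define F where "F = A - (\<theta> * f_one A B D ?X) *\<^sub>R B"
  define N where "N = F + (1 / 2) *\<^sub>R (D ** transpose ?X + ?X ** transpose D)"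
  define \<gamma> where "\<gamma> = 2 / trace (transpose ?X ** B ** ?X) powr \<theta>"
  have \<gamma>: "\<gamma> > 0" using pos by (simp add: \<gamma>_def)
  have E: "E_mat \<theta> A B D ?X = \<gamma> *\<^sub>R N"
    by (simp add: E_mat_def \<gamma>_def N_def F_def algebra_simps)
  have locF: "local_maximizer_on (f_num F D) stiefel ?X"
    unfolding F_def by (rule local_maximizer_on_linearized) (use assms num loc in auto)
  have symF: "symmetric_mat F"
    using assms(2,3) unfolding F_def psd_def symmetric_mat_def
    by (simp add: transpose_def vec_eq_iff)
  have "transpose (D ** transpose ?X + ?X ** transpose D) = D ** transpose ?X + ?X ** transpose D"
    by (simp add: transpose_def matrix_matrix_mult_def vec_eq_iff mult.commute add.commute)
  then have symE: "symmetric_mat (\<gamma> *\<^sub>R N)"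
    using symF unfolding N_def symmetric_mat_def by (simp add: transpose_def vec_eq_iff)
  note conds = quadratic_local_maximizer_conditions[OF locF symF XD, folded N_def]
  let ?V = "range ((*v) ?X)"
  have V: "subspace ?V" by (intro linear_subspace_image) auto
  have perp: "w \<bullet> (?X *v p) = 0" if "w \<in> ?V\<^sup>\<bottom>" for w p
    using that by (auto simp: orthogonal_comp_def orthogonal_def inner_commute)
  have EV: "(\<gamma> *\<^sub>R N) *v v = \<gamma> *\<^sub>R (N *v v)" for v
    by (simp add: scaleR_matrix_vector_assoc)
  have "top_invariant_subspace (dim ?V) (\<gamma> *\<^sub>R N) ?V"
  proof (rule top_invariant_subspaceI[OF symE V])
    fix v w assume v: "v \<in> ?V" and w: "w \<in> ?V\<^sup>\<bottom>"
    then obtain q where q: "v = ?X *v q" by blast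
    \<comment> \<open>The conditions concern unit vectors; orthogonality extends to all vectors by scaling.\<close>
    show "w \<bullet> ((\<gamma> *\<^sub>R N) *v v) = 0"
    proof (cases "q = 0 \<or> w = 0")
      case False
      have "sgn w \<bullet> (N *v (?X *v sgn q)) = 0"
        using False perp[OF w] by (intro conds(1)) (auto simp: sgn_div_norm dot_square_norm power2_eq_square)
      then show ?thesis
        using False by (simp add: EV q sgn_div_norm matrix_vector_mult_scaleR)
    qed (auto simp: q)
    assume "v \<bullet> v = 1" "w \<bullet> w = 1"
    then show "w \<bullet> ((\<gamma> *\<^sub>R N) *v w) \<le> v \<bullet> ((\<gamma> *\<^sub>R N) *v v)"
      using conds(2)[of q w] X perp[OF w] \<gamma> unfolding EV stiefel_iff_inner q by simp
  qed
  then have "top_invariant_subspace CARD('k) (E_mat \<theta> A B D ?X) ?V"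
    by (simp add: dim_range_stiefel[OF X] E)
  moreover have "orthonormal_basis_matrix ?X ?V"
    using X by (simp add: orthonormal_basis_matrix_def span_columns_eq_range)
  ultimately show "\<exists>V. top_invariant_subspace CARD('k) (E_mat \<theta> A B D ?X) V \<and> orthonormal_basis_matrix ?X V"
    by blast
qed

end
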